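(* We have $$\min_{t \in \mathbb{R}} \left|P_n(e^{it})\right|^2 \leq (n+1) - \frac{\log n}{4\pi} < (n+1) + \frac{\log n}{4\pi} \leq \max_{t \in \mathbb{R}} \left|P_n(e^{it})\right|^2$$ for every polynomial $P_n \in \mathcal{L}_n$, that is, for every polynomial $P_n(z) = \sum_{k=0}^n a_k z^k$ with $a_k \in \{-1,1\}$ for all $k = 0,1,\ldots,n$.
   Context: $\mathcal{L}_n$ denotes the set of Littlewood polynomials of degree $n$, i.e. all polynomials $P_n(z) = \sum_{k=0}^n a_k z^k$ with every coefficient $a_k \in \{-1,1\}$.
   Formalization: The degree n is taken to be at least 1, since log 0 is undefined, and the strict middle inequality is claimed only for n ≥ 2, because for n = 1 it would read 2 < 2; the two outer inequalities hold for all n ≥ 1. *)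

theory Defs
  imports
    "HOL-Analysis.Analysis"
    "HOL-Computational_Algebra.Polynomial"
begin

definition littlewood_polys :: "nat \<Rightarrow> complex poly set" where
  "littlewood_polys n = {P. degree P = n \<and> (\<forall>k\<le>n. coeff P k \<in> {-1, 1})}"

text \<open>The minimum and the maximum over all real \<open>t\<close> are the least and the greatest element of
  the set of values. They exist because the function is continuous and \<open>2 * pi\<close>-periodic, so
  the description operators behind \<open>Least\<close> and \<open>Greatest\<close> are well determined.\<close>

definition min_sq_mod_circle :: "complex poly \<Rightarrow> real" where
  "min_sq_mod_circle P =
     (LEAST y. y \<in> range (\<lambda>t::real. (cmod (poly P (exp (\<i> * of_real t))))\<^sup>2))"

definition max_sq_mod_circle :: "complex poly \<Rightarrow> real" where
  "max_sq_mod_circle P =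
     (GREATEST y. y \<in> range (\<lambda>t::real. (cmod (poly P (exp (\<i> * of_real t))))\<^sup>2))"

end

theory Submission
  imports
    Defs
    "HOL-Complex_Analysis.Complex_Analysis"
    "HOL-Computational_Algebra.Fundamental_Theorem_Algebra"
begin

text \<open>The function \<open>f t = |P (cis t)|^2 - (n + 1)\<close> has mean zero and equals
  \<open>cis t ^ (-n) * F (cis t)\<close> for the polynomial
  \<open>F = P * reflect_poly P - (n + 1) z^n\<close>. The coefficient of \<open>z^k\<close> in
  \<open>P * reflect_poly P\<close> is a sum of \<open>n + 1 - |k - n|\<close> signs, hence odd when \<open>k\<close>
  is even. Hardy's inequality bounds the integral of \<open>|f|\<close> over a period from below by
  \<open>2 * (\<Sum>k. |F_k| / (k + 1))\<close>, and the even \<open>k \<noteq> n\<close> alone make this at least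
  \<open>ln n\<close>. Since \<open>f\<close> has mean zero, \<open>f \<le> M\<close> forces the same integral
  to be at most \<open>4 * pi * M\<close>; the same applies to \<open>-f\<close>.

  Hardy's inequality follows from Hilbert's by writing \<open>F = G * H\<close> with
  \<open>|G| = |H|\<close> on the unit circle.\<close>


section \<open>Fourier analysis over one period and Hilbert's inequality\<close>

lemma has_integral_cis:
  fixes k :: int
  shows "((\<lambda>t. cis (of_int k * t)) has_integral (if k = 0 then 2 * of_real pi else 0)) {0..2 * pi}"
proof (cases "k = 0")
  case True
  have "((\<lambda>t::real. 1 :: complex) has_integral (2 * pi - 0) *\<^sub>R 1) {0..2 * pi}"
    using has_integral_const_real[of "1::complex" 0 "2 * pi"] by simp
  then show ?thesis
    using True by (simp add: scaleR_conv_of_real)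
next
  case False
  define E where "E t = exp (\<i> * of_int k * of_real t) / (\<i> * of_int k)" for t :: real
  have "((\<lambda>t. exp (\<i> * of_int k * of_real t)) has_integral (E (2 * pi) - E 0)) {0..2 * pi}"
    unfolding E_def
    by (rule fundamental_theorem_of_calculus)
       (auto intro!: has_vector_derivative_real_field derivative_eq_intros simp: False)
  moreover have "E (2 * pi) = E 0"
    unfolding E_def using exp_integer_2pi[of "of_int k"] by (simp add: mult_ac)
  ultimately show ?thesis
    using False by (simp add: cis_conv_exp mult_ac)
qed

lemma has_integral_sawtooth_cis:
  fixes k :: int
  assumes "k \<noteq> 0"
  shows "((\<lambda>t. of_real (t - pi) * cis (of_int k * t)) has_integral 2 * of_real pi / (\<i> * of_int k)) {0..2 * pi}"
proof -
  \<comment> \<open>An antiderivative from one integration by parts. Its second summand is periodic,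
    so only the change of \<open>t - pi\<close> from \<open>-pi\<close> to \<open>pi\<close>
    contributes.\<close>
  define E where
    "E t = (of_real t - of_real pi) * exp (\<i> * of_int k * of_real t) / (\<i> * of_int k)
           + exp (\<i> * of_int k * of_real t) / (of_int k)\<^sup>2" for t :: real
  have "((\<lambda>t. (of_real t - of_real pi) * exp (\<i> * of_int k * of_real t))
          has_integral (E (2 * pi) - E 0)) {0..2 * pi}"
    unfolding E_def
    by (rule fundamental_theorem_of_calculus)
       (auto intro!: has_vector_derivative_real_field derivative_eq_intros
             simp: assms divide_simps power2_eq_square algebra_simps)
  moreover have "exp (\<i> * of_int k * of_real (2 * pi)) = 1"
    using exp_integer_2pi[of "of_int k"] by (simp add: mult_ac)
  then have "E (2 * pi) - E 0 = 2 * of_real pi / (\<i> * of_int k)"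
    unfolding E_def by (simp add: field_simps)
  ultimately show ?thesis
    by (simp add: cis_conv_exp mult_ac)
qed

lemma parseval_finite:
  fixes x :: "nat \<Rightarrow> complex"
  shows "((\<lambda>t. (cmod (\<Sum>k\<in>A. x k * cis (real k * t)))\<^sup>2)
           has_integral 2 * pi * (\<Sum>k\<in>A. (cmod (x k))\<^sup>2)) {0..2 * pi}"
proof (cases "finite A")
  case True
  have eq: "of_real ((cmod (\<Sum>k\<in>A. x k * cis (real k * t)))\<^sup>2)
      = (\<Sum>i\<in>A. \<Sum>j\<in>A. x i * cnj (x j) * cis (of_int (int i - int j) * t))" for t
    unfolding complex_norm_square cnj_sum sum_product
    by (intro sum.cong refl) (simp add: cis_mult cis_cnj algebra_simps)
  have "((\<lambda>t. \<Sum>i\<in>A. \<Sum>j\<in>A. x i * cnj (x j) * cis (of_int (int i - int j) * t)) has_integral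
         (\<Sum>i\<in>A. \<Sum>j\<in>A. x i * cnj (x j) * (if int i - int j = 0 then 2 * of_real pi else 0))) {0..2 * pi}"
    using True by (intro has_integral_sum has_integral_mult_right has_integral_cis) auto
  also have "(\<Sum>i\<in>A. \<Sum>j\<in>A. x i * cnj (x j) * (if int i - int j = 0 then 2 * of_real pi else 0))
      = (\<Sum>i\<in>A. \<Sum>j\<in>A. if i = j then 2 * of_real pi * (x i * cnj (x j)) else 0)"
    by (intro sum.cong refl) auto
  also have "\<dots> = of_real (2 * pi * (\<Sum>k\<in>A. (cmod (x k))\<^sup>2))"
    using True by (simp add: sum_distrib_left complex_norm_square[symmetric])
  finally have "((\<lambda>t. complex_of_real ((cmod (\<Sum>k\<in>A. x k * cis (real k * t)))\<^sup>2))
      has_integral of_real (2 * pi * (\<Sum>k\<in>A. (cmod (x k))\<^sup>2))) {0..2 * pi}"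
    unfolding eq .
  from has_integral_Re[OF this] show ?thesis by simp
\<comment> \<open>For infinite \<open>A\<close> all the sums are 0 by convention.\<close>
qed auto

text \<open>Integrating \<open>|g - S|^2 \<ge> 0\<close> for the Fourier sum \<open>S\<close> over
  \<open>A\<close> gives the bound: the integrals of \<open>g * cnj S\<close> and of
  \<open>|S|^2\<close> are both \<open>2 * pi * s\<close>.\<close>

lemma bessel_finite:
  fixes g :: "real \<Rightarrow> complex" and c :: "nat \<Rightarrow> complex"
  assumes cont: "continuous_on {0..2 * pi} g"
    and c: "\<And>k. k \<in> A \<Longrightarrow> ((\<lambda>t. g t * cis (- (real k * t))) has_integral 2 * of_real pi * c k) {0..2 * pi}"
    and fin: "finite A"
  shows "2 * pi * (\<Sum>k\<in>A. (cmod (c k))\<^sup>2) \<le> integral {0..2 * pi} (\<lambda>t. (cmod (g t))\<^sup>2)"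
proof -
  define S where "S t = (\<Sum>k\<in>A. c k * cis (real k * t))" for t
  define s where "s = (\<Sum>k\<in>A. (cmod (c k))\<^sup>2)"
  have g: "((\<lambda>t. (cmod (g t))\<^sup>2) has_integral integral {0..2 * pi} (\<lambda>t. (cmod (g t))\<^sup>2)) {0..2 * pi}"
    by (intro integrable_integral integrable_continuous_interval continuous_intros cont)
  have S: "((\<lambda>t. (cmod (S t))\<^sup>2) has_integral 2 * pi * s) {0..2 * pi}"
    unfolding S_def s_def by (rule parseval_finite)
  have "((\<lambda>t. \<Sum>k\<in>A. cnj (c k) * (g t * cis (- (real k * t)))) has_integral
        (\<Sum>k\<in>A. cnj (c k) * (2 * of_real pi * c k))) {0..2 * pi}"
    by (intro has_integral_sum has_integral_mult_right c fin)
  also have "(\<lambda>t. \<Sum>k\<in>A. cnj (c k) * (g t * cis (- (real k * t)))) = (\<lambda>t. g t * cnj (S t))"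
    unfolding S_def by (auto simp: sum_distrib_left cis_cnj mult_ac)
  also have "(\<Sum>k\<in>A. cnj (c k) * (2 * of_real pi * c k)) = of_real (2 * pi * s)"
    unfolding s_def by (simp add: sum_distrib_left complex_norm_square mult_ac del: of_real_power)
  finally have "((\<lambda>t. g t * cnj (S t)) has_integral of_real (2 * pi * s)) {0..2 * pi}" .
  from has_integral_Re[OF this] have gS: "((\<lambda>t. Re (g t * cnj (S t))) has_integral 2 * pi * s) {0..2 * pi}"
    by (simp only: Re_complex_of_real)
  have "((\<lambda>t. (cmod (g t))\<^sup>2 + (cmod (S t))\<^sup>2 - 2 * Re (g t * cnj (S t))) has_integral
        (integral {0..2 * pi} (\<lambda>t. (cmod (g t))\<^sup>2) + 2 * pi * s - 2 * (2 * pi * s))) {0..2 * pi}"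
    by (intro has_integral_add has_integral_diff has_integral_mult_right g S gS)
  also have "(\<lambda>t. (cmod (g t))\<^sup>2 + (cmod (S t))\<^sup>2 - 2 * Re (g t * cnj (S t))) = (\<lambda>t. (cmod (g t - S t))\<^sup>2)"
    unfolding cmod_power2 by (auto simp: power2_eq_square algebra_simps)
  finally have "0 \<le> integral {0..2 * pi} (\<lambda>t. (cmod (g t))\<^sup>2) + 2 * pi * s - 2 * (2 * pi * s)"
    by (rule has_integral_nonneg) simp
  then show ?thesis unfolding s_def by simp
qed

text \<open>The kernel \<open>1 / (i + j + 1)\<close> consists of Fourier coefficients of the sawtooth
  \<open>t - pi\<close>, whose sup norm on a period is the constant \<open>pi\<close> of the inequality.\<close>

lemma hilbert_inequality:
  fixes x y :: "nat \<Rightarrow> real"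
  shows "(\<Sum>i<N. \<Sum>j<N. x i * y j / (real i + real j + 1))
           \<le> pi / 2 * ((\<Sum>i<N. (x i)\<^sup>2) + (\<Sum>j<N. (y j)\<^sup>2))"
proof -
  define X Y where "X t = (\<Sum>i<N. complex_of_real (x i) * cis (real i * t))"
    and "Y t = (\<Sum>j<N. complex_of_real (y j) * cis (real j * t))" for t
  define h where "h = (\<Sum>i<N. \<Sum>j<N. x i * y j / (real i + real j + 1))"
  \<comment> \<open>The factor \<open>cis t\<close> shifts the frequency \<open>i + j\<close> to
    \<open>i + j + 1\<close>, which is never zero and yields the denominator of the kernel.\<close>
  define K where "K t = of_real (t - pi) * cis t * (X t * Y t)" for t
  have XY: "((\<lambda>t. (cmod (X t))\<^sup>2) has_integral 2 * pi * (\<Sum>i<N. (x i)\<^sup>2)) {0..2 * pi}"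
    "((\<lambda>t. (cmod (Y t))\<^sup>2) has_integral 2 * pi * (\<Sum>j<N. (y j)\<^sup>2)) {0..2 * pi}"
    unfolding X_def Y_def
    using parseval_finite[of "\<lambda>i. of_real (x i)" "{..<N}"] parseval_finite[of "\<lambda>i. of_real (y i)" "{..<N}"]
    by simp_all
  have "((\<lambda>t. \<Sum>i<N. \<Sum>j<N. of_real (x i * y j) *
            (of_real (t - pi) * cis (of_int (int i + int j + 1) * t))) has_integral
         (\<Sum>i<N. \<Sum>j<N. of_real (x i * y j) * (2 * of_real pi / (\<i> * of_int (int i + int j + 1))))) {0..2 * pi}"
    by (intro has_integral_sum has_integral_mult_right has_integral_sawtooth_cis finite_lessThan) linarith
  also have "(\<lambda>t. \<Sum>i<N. \<Sum>j<N. of_real (x i * y j) *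
            (of_real (t - pi) * cis (of_int (int i + int j + 1) * t))) = K"
    unfolding K_def X_def Y_def sum_product
    by (auto intro!: sum.cong simp: sum_distrib_left cis_mult ring_distribs simp flip: cis_mult)
  also have "(\<Sum>i<N. \<Sum>j<N. of_real (x i * y j) * (2 * of_real pi / (\<i> * of_int (int i + int j + 1))))
      = 2 * of_real pi * of_real h / \<i>"
    unfolding h_def of_real_sum sum_distrib_left sum_divide_distrib
    by (intro sum.cong refl) (simp add: divide_inverse mult_ac)
  finally have K: "(K has_integral 2 * of_real pi * of_real h / \<i>) {0..2 * pi}" .
  have bound: "cmod (K t) \<le> pi / 2 * ((cmod (X t))\<^sup>2 + (cmod (Y t))\<^sup>2)" if "t \<in> {0..2 * pi}" for t
  proof -
    have "cmod (K t) = \<bar>t - pi\<bar> * (cmod (X t) * cmod (Y t))"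
      unfolding K_def by (simp add: norm_mult flip: of_real_diff)
    also have "\<dots> \<le> pi * (((cmod (X t))\<^sup>2 + (cmod (Y t))\<^sup>2) / 2)"
      using that sum_squares_bound[of "cmod (X t)" "cmod (Y t)"]
      by (intro mult_mono) auto
    finally show ?thesis by simp
  qed
  have B: "((\<lambda>t. pi / 2 * ((cmod (X t))\<^sup>2 + (cmod (Y t))\<^sup>2)) has_integral
      pi / 2 * (2 * pi * (\<Sum>i<N. (x i)\<^sup>2) + 2 * pi * (\<Sum>j<N. (y j)\<^sup>2))) {0..2 * pi}"
    by (intro has_integral_mult_right has_integral_add XY)
  have "cmod (integral {0..2 * pi} K) \<le> integral {0..2 * pi} (\<lambda>t. pi / 2 * ((cmod (X t))\<^sup>2 + (cmod (Y t))\<^sup>2))"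
    using K B bound by (intro integral_norm_bound_integral has_integral_integrable) auto
  then have "cmod (2 * of_real pi * of_real h / \<i>)
      \<le> pi / 2 * (2 * pi * (\<Sum>i<N. (x i)\<^sup>2) + 2 * pi * (\<Sum>j<N. (y j)\<^sup>2))"
    unfolding integral_unique[OF K] integral_unique[OF B] .
  then have "2 * pi * \<bar>h\<bar> \<le> 2 * pi * (pi / 2 * ((\<Sum>i<N. (x i)\<^sup>2) + (\<Sum>j<N. (y j)\<^sup>2)))"
    by (simp add: norm_divide norm_mult algebra_simps)
  then show ?thesis unfolding h_def by simp
qed

section \<open>Splitting a polynomial evenly on the unit circle\<close>

text \<open>Although 0 lies on the branch cut, continuity holds there because
  \<open>|csqrt z| = sqrt |z|\<close>. This serves roots on the unit circle, where
  \<open>1 - a * z\<close> reaches 0.\<close>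

lemma continuous_at_csqrt_0: "continuous (at 0) csqrt"
proof -
  have "((\<lambda>z. sqrt (cmod z)) \<longlongrightarrow> sqrt (cmod 0)) (at (0::complex))"
    by (intro tendsto_intros)
  then have "((\<lambda>z. cmod (csqrt z)) \<longlongrightarrow> 0) (at 0)"
    by simp
  then show ?thesis
    unfolding continuous_within csqrt_0 by (rule tendsto_norm_zero_cancel)
qed

text \<open>For \<open>|a * z| \<le> 1\<close> the point \<open>1 - a * z\<close> lies in the closed
  disc of radius 1 about 1, which meets the branch cut only at 0. Within the unit disc, 0 can be
  reached only on the boundary, where continuity is enough.\<close>

lemma csqrt_one_minus:
  assumes "cmod a \<le> 1"
  shows "(\<lambda>z. csqrt (1 - a * z)) holomorphic_on ball 0 1"
    and "continuous_on (cball 0 1) (\<lambda>z. csqrt (1 - a * z))"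
proof -
  have Re: "1 - a * z = 0 \<or> Re (1 - a * z) > 0" if "cmod (a * z) \<le> 1" for z
  proof (cases "Re (a * z) = 1")
    case True
    with that have "(Im (a * z))\<^sup>2 \<le> 0"
      using cmod_power2[of "a * z"] power_le_one[of "cmod (a * z)" 2] by simp
    with True show ?thesis by (simp add: complex_eq_iff)
  next
    case False
    with that complex_Re_le_cmod[of "a * z"] show ?thesis by simp
  qed
  show "(\<lambda>z. csqrt (1 - a * z)) holomorphic_on ball 0 1"
  proof (intro holomorphic_intros)
    fix z :: complex assume z: "z \<in> ball 0 1"
    have "cmod (a * z) \<le> cmod z"
      using assms by (simp add: norm_mult mult_left_le_one_le)
    with z have "cmod (a * z) < 1" by simp
    moreover from this have "1 - a * z \<noteq> 0" by auto
    ultimately show "1 - a * z \<notin> \<real>\<^sub>\<le>\<^sub>0"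
      using Re[of z] by (auto simp: complex_nonpos_Reals_iff)
  qed
  show "continuous_on (cball 0 1) (\<lambda>z. csqrt (1 - a * z))"
  proof (intro continuous_at_imp_continuous_on ballI)
    fix z :: complex assume z: "z \<in> cball 0 1"
    then have "cmod (a * z) \<le> 1"
      using assms by (simp add: norm_mult mult_le_one)
    from Re[OF this] have "isCont csqrt (1 - a * z)"
      using continuous_at_csqrt_0 continuous_at_csqrt[of "1 - a * z"]
      by (metis complex_nonpos_Reals_iff not_less)
    then show "isCont (\<lambda>z. csqrt (1 - a * z)) z"
      by (rule isCont_o2[rotated]) (intro continuous_intros)
  qed
qed

text \<open>Substitute for the factorization of an \<open>H^1\<close> function into two \<open>H^2\<close> functions. A root
  \<open>r\<close> inside the disc contributes its Blaschke factor to \<open>G\<close> and the square root of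
  \<open>1 - cnj r * z\<close> to both factors; any other root only contributes a square root.\<close>

lemma poly_balanced_factorization:
  fixes F :: "complex poly"
  shows "\<exists>G H. G holomorphic_on ball 0 1 \<and> H holomorphic_on ball 0 1 \<and>
    continuous_on (cball 0 1) G \<and> continuous_on (cball 0 1) H \<and>
    (\<forall>z\<in>cball 0 1. poly F z = G z * H z) \<and> (\<forall>z\<in>sphere 0 1. cmod (G z) = cmod (H z))"
proof (induction "degree F" arbitrary: F)
  case 0
  then obtain c where "F = [:c:]" using degree_eq_zeroE by metis
  then show ?case
    by (intro exI[of _ "\<lambda>_. csqrt c"]) (auto simp flip: power2_eq_square)
next
  case (Suc d)
  then have "\<not> constant (poly F)" by (simp add: constant_degree)
  then obtain r where "poly F r = 0" using fundamental_theorem_of_algebra by blast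
  then obtain F1 where F: "F = [:-r, 1:] * F1" by (auto simp: poly_eq_0_iff_dvd)
  with Suc(2) have "F1 \<noteq> 0" by auto
  then have "degree F = Suc (degree F1)"
    unfolding F by (subst degree_mult_eq) auto
  with Suc(2) have "d = degree F1" by simp
  from Suc(1)[OF this] obtain G H where
    hol: "G holomorphic_on ball 0 1" "H holomorphic_on ball 0 1"
    and cont: "continuous_on (cball 0 1) G" "continuous_on (cball 0 1) H"
    and GH: "\<forall>z\<in>cball 0 1. poly F1 z = G z * H z"
    and eq: "\<forall>z\<in>sphere 0 1. cmod (G z) = cmod (H z)" by blast
  have FGH: "poly F z = (z - r) * (G z * H z)" if "cmod z \<le> 1" for z
    using GH that by (simp add: F algebra_simps)
  show ?case
  proof (cases "cmod r < 1")
    case True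
    define s where "s z = csqrt (1 - cnj r * z)" for z
    have s: "s holomorphic_on ball 0 1" "continuous_on (cball 0 1) s"
      unfolding s_def using csqrt_one_minus[of "cnj r"] True by simp_all
    have nz: "s z \<noteq> 0" if "cmod z \<le> 1" for z
    proof
      assume "s z = 0"
      then have "cnj r * z = 1" unfolding s_def by simp
      then have "cmod r * cmod z = 1" by (metis complex_mod_cnj norm_mult norm_one)
      moreover have "cmod r * cmod z \<le> cmod r" using that by (simp add: mult_left_le)
      ultimately show False using True by simp
    qed
    \<comment> \<open>On the circle, \<open>z\<close> times the conjugate of \<open>z - r\<close> is
      \<open>1 - cnj r * z\<close>, so the Blaschke factor \<open>(z - r) / (s z)^2\<close> has
      modulus 1 there.\<close>
    have mod: "cmod (z - r) = (cmod (s z))\<^sup>2" if "cmod z = 1" for z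
    proof -
      have "z * cnj z = 1" using that by (simp add: complex_norm_square[symmetric])
      then have "z * cnj (z - r) = (s z)\<^sup>2" unfolding s_def by (simp add: algebra_simps)
      then show ?thesis using that by (metis complex_mod_cnj mult_1 norm_mult norm_power)
    qed
    \<comment> \<open>\<open>(z - r) / s z\<close> is the Blaschke factor times
      \<open>s z\<close>.\<close>
    show ?thesis
      by (rule exI[of _ "\<lambda>z. G z * ((z - r) / s z)"], rule exI[of _ "\<lambda>z. H z * s z"])
         (intro conjI holomorphic_intros continuous_intros hol cont s;
          use nz eq mod in \<open>auto simp: FGH norm_mult norm_divide power2_eq_square\<close>)
  next
    case False
    then have r: "r \<noteq> 0" "cmod (1 / r) \<le> 1" by (auto simp: norm_divide divide_simps)
    define s where "s z = csqrt (1 - 1 / r * z)" for z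
    have s: "s holomorphic_on ball 0 1" "continuous_on (cball 0 1) s"
      unfolding s_def using csqrt_one_minus[OF r(2)] by simp_all
    \<comment> \<open>Writing \<open>z - r\<close> as \<open>-r * (1 - z / r)\<close> puts it in the
      form whose square root is available on the whole closed disc.\<close>
    have sq: "z - r = (csqrt (-r) * s z)\<^sup>2" for z
      unfolding s_def power_mult_distrib power2_csqrt using r by (simp add: field_simps)
    show ?thesis
      by (rule exI[of _ "\<lambda>z. G z * (csqrt (-r) * s z)"],
          rule exI[of _ "\<lambda>z. H z * (csqrt (-r) * s z)"])
         (intro conjI holomorphic_intros continuous_intros hol cont s;
          use eq sq in \<open>auto simp: FGH norm_mult power2_eq_square\<close>)
  qed
qed

section \<open>Hardy's inequality for polynomials\<close>

text \<open>Cauchy's formula for derivatives on the unit circle identifies Taylor coefficients at 0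
  with Fourier coefficients of the boundary values, as \<open>bessel_finite\<close>
  requires.\<close>

lemma has_integral_taylor_coeff:
  assumes "continuous_on (cball 0 1) G" "G holomorphic_on ball 0 1"
  shows "((\<lambda>t. G (cis t) * cis (- (real k * t))) has_integral
           2 * of_real pi * ((deriv ^^ k) G 0 / fact k)) {0..2 * pi}"
proof -
  have "((\<lambda>u. G u / (u - 0) ^ Suc k) has_contour_integral (2 * pi * \<i> / fact k * (deriv ^^ k) G 0))
      (part_circlepath 0 1 0 (2 * pi))"
    using Cauchy_has_contour_integral_higher_derivative_circlepath[OF assms, of 0 k]
    unfolding circlepath_def by simp
  then have "((\<lambda>t. G (cis t) / cis t ^ Suc k * \<i> * cis t) has_integral
      2 * pi * \<i> / fact k * (deriv ^^ k) G 0) {0..2 * pi}"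
    by (subst (asm) has_contour_integral_part_circlepath_iff) auto
  then have "((\<lambda>t. 1 / \<i> * (G (cis t) / cis t ^ Suc k * \<i> * cis t)) has_integral
      1 / \<i> * (2 * pi * \<i> / fact k * (deriv ^^ k) G 0)) {0..2 * pi}"
    by (rule has_integral_mult_right)
  moreover have "1 / \<i> * (G (cis t) / cis t ^ Suc k * \<i> * cis t) = G (cis t) * cis (- (real k * t))" for t
    unfolding power_Suc Complex.DeMoivre cis_inverse[symmetric] by (simp add: field_simps)
  ultimately show ?thesis by (simp add: mult_ac)
qed


text \<open>The coefficients of \<open>F = G * H\<close> are convolutions of Taylor coefficients, so
  Hilbert's inequality reduces the sum to two square sums. Bessel controls both by the integral of
  \<open>|F|\<close>, since \<open>|G|^2 = |H|^2 = |F|\<close> on the circle.\<close>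

lemma hardy_inequality_poly:
  fixes F :: "complex poly"
  shows "(\<Sum>k<N. cmod (coeff F k) / (real k + 1)) \<le> integral {0..2 * pi} (\<lambda>t. cmod (poly F (cis t))) / 2"
proof -
  obtain G H where
    hol: "G holomorphic_on ball 0 1" "H holomorphic_on ball 0 1"
    and cont: "continuous_on (cball 0 1) G" "continuous_on (cball 0 1) H"
    and GH: "\<And>z. z \<in> cball 0 1 \<Longrightarrow> poly F z = G z * H z"
    and eq: "\<And>z. z \<in> sphere 0 1 \<Longrightarrow> cmod (G z) = cmod (H z)"
    using poly_balanced_factorization[of F] by blast
  define g h where "g = fps_nth (fps_expansion G 0)" and "h = fps_nth (fps_expansion H 0)"
  define I where "I = integral {0..2 * pi} (\<lambda>t. cmod (poly F (cis t)))"

  have exp: "G has_fps_expansion fps_expansion G 0" "H has_fps_expansion fps_expansion H 0"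
    using has_fps_expansion_fps_expansion[of "ball 0 1"] hol by auto
  have "eventually (\<lambda>z::complex. z \<in> ball 0 1) (nhds 0)"
    by (intro eventually_nhds_in_open) auto
  then have "eventually (\<lambda>z. G z * H z = poly F z) (nhds 0)"
    by eventually_elim (simp add: GH)
  moreover have "poly F has_fps_expansion fps_of_poly F"
    by (auto simp: has_fps_expansion_def)
  ultimately have "(\<lambda>z. G z * H z) has_fps_expansion fps_of_poly F"
    using has_fps_expansion_cong[of "\<lambda>z. G z * H z" "poly F"] by blast
  then have "fps_of_poly F = fps_expansion G 0 * fps_expansion H 0"
    using fps_expansion_unique_complex has_fps_expansion_mult[OF exp] by blast
  then have coeff: "coeff F k = (\<Sum>i\<le>k. g i * h (k - i))" for k
    unfolding g_def h_def by (metis fps_mult_nth fps_of_poly_nth atLeast0AtMost)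

  have bessel: "2 * pi * (\<Sum>k<N. (cmod (fps_nth (fps_expansion K 0) k))\<^sup>2) \<le> I"
    if "K holomorphic_on ball 0 1" "continuous_on (cball 0 1) K"
      "\<And>z. z \<in> sphere 0 1 \<Longrightarrow> cmod (poly F z) = (cmod (K z))\<^sup>2" for K
  proof -
    have "continuous_on {0..2 * pi} (\<lambda>t. K (cis t))"
      by (rule continuous_on_compose2[OF that(2)]) (auto intro!: continuous_intros)
    then have "2 * pi * (\<Sum>k<N. (cmod (fps_nth (fps_expansion K 0) k))\<^sup>2)
        \<le> integral {0..2 * pi} (\<lambda>t. (cmod (K (cis t)))\<^sup>2)"
      by (rule bessel_finite)
         (use has_integral_taylor_coeff[OF that(2,1)] in \<open>auto simp: fps_expansion_def\<close>)
    also have "\<dots> = I"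
      unfolding I_def by (intro integral_cong) (simp add: that(3))
    finally show ?thesis .
  qed
  have sq: "2 * pi * (\<Sum>i<N. (cmod (g i))\<^sup>2) \<le> I" "2 * pi * (\<Sum>j<N. (cmod (h j))\<^sup>2) \<le> I"
    unfolding g_def h_def
    by (rule bessel; use hol cont eq in \<open>auto simp: GH norm_mult power2_eq_square\<close>)+

  define A where "A i j = cmod (g i) * cmod (h j) / (real i + real j + 1)" for i j
  have "(\<Sum>k<N. cmod (coeff F k) / (real k + 1)) \<le> (\<Sum>k<N. \<Sum>i\<le>k. A i (k - i))"
  proof (intro sum_mono)
    fix k
    have "cmod (coeff F k) \<le> (\<Sum>i\<le>k. cmod (g i) * cmod (h (k - i)))"
      unfolding coeff by (rule order_trans[OF norm_sum]) (simp add: norm_mult)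
    then have "cmod (coeff F k) / (real k + 1) \<le> (\<Sum>i\<le>k. cmod (g i) * cmod (h (k - i))) / (real k + 1)"
      by (intro divide_right_mono) auto
    also have "\<dots> = (\<Sum>i\<le>k. A i (k - i))"
      unfolding A_def sum_divide_distrib by (intro sum.cong) (auto simp: of_nat_diff)
    finally show "cmod (coeff F k) / (real k + 1) \<le> (\<Sum>i\<le>k. A i (k - i))" .
  qed
  \<comment> \<open>The antidiagonals fill a triangle; as all terms are nonnegative, it may be
    enlarged to the square of Hilbert's inequality.\<close>
  also have "\<dots> = (\<Sum>(i, j)\<in>{(i, j). i + j < N}. A i j)"
    by (rule sum.triangle_reindex[symmetric])
  also have "\<dots> \<le> (\<Sum>(i, j)\<in>{..<N} \<times> {..<N}. A i j)"
    by (intro sum_mono2) (auto simp: A_def)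
  also have "\<dots> = (\<Sum>i<N. \<Sum>j<N. A i j)"
    by (rule sum.cartesian_product[symmetric])
  also have "\<dots> \<le> pi / 2 * ((\<Sum>i<N. (cmod (g i))\<^sup>2) + (\<Sum>j<N. (cmod (h j))\<^sup>2))"
    unfolding A_def by (rule hilbert_inequality)
  \<comment> \<open>Each square sum is at most \<open>I / (2 * pi)\<close>, which cancels the
    constant \<open>pi\<close>.\<close>
  also have "\<dots> \<le> I / 2"
    using sq by (simp add: algebra_simps)
  finally show ?thesis unfolding I_def .
qed

text \<open>Mean zero forces \<open>M \<ge> 0\<close>, hence \<open>|f| \<le> 2 * M - f\<close>
  whatever the sign of \<open>f\<close>. Integration removes \<open>f\<close> and leaves
  \<open>4 * pi * M\<close>, which Hardy's inequality halves.\<close>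

lemma hardy_one_sided:
  fixes F :: "complex poly" and f :: "real \<Rightarrow> real"
  assumes f: "(f has_integral 0) {0..2 * pi}"
    and abs_f: "\<And>t. \<bar>f t\<bar> = cmod (poly F (cis t))"
    and le: "\<And>t. f t \<le> M"
  shows "(\<Sum>k<N. cmod (coeff F k) / (real k + 1)) \<le> 2 * pi * M"
proof -
  have const: "((\<lambda>t::real. c) has_integral 2 * pi * c) {0..2 * pi}" for c :: real
    using has_integral_const_real[of c 0 "2 * pi"] by simp
  have "0 \<le> 2 * pi * M"
    by (rule has_integral_le[OF f const]) (rule le)
  then have M: "M \<ge> 0" using pi_gt_zero by (simp add: zero_le_mult_iff)
  have F: "((\<lambda>t. cmod (poly F (cis t))) has_integral integral {0..2 * pi} (\<lambda>t. cmod (poly F (cis t)))) {0..2 * pi}"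
    by (intro integrable_integral integrable_continuous_interval continuous_intros)
  have "cmod (poly F (cis t)) \<le> 2 * M - f t" for t
    using le[of t] M by (simp flip: abs_f)
  then have "integral {0..2 * pi} (\<lambda>t. cmod (poly F (cis t))) \<le> 2 * pi * (2 * M) - 0"
    using has_integral_le[OF F has_integral_diff[OF const f]] by blast
  with hardy_inequality_poly[of F N] show ?thesis by simp
qed

section \<open>Coefficient parity and the logarithmic lower bound\<close>

text \<open>Comparison with half the harmonic sum, since \<open>2 * m + 1 \<le> 2 * (m + 1)\<close>.
  The subtracted \<open>1 / (n + 1)\<close> is the weight of the middle coefficient
  \<open>k = n\<close>, for which parity gives no lower bound in \<open>F\<close>.\<close>

lemma sum_inverse_odd_ge:
  "ln (real n) / 2 \<le> (\<Sum>m\<le>n. 1 / (2 * real m + 1)) - 1 / (real n + 1)" if "n \<ge> 1"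
proof -
  have "ln (real n / (real n + 1)) \<le> real n / (real n + 1) - 1"
    using that by (intro ln_le_minus_one) auto
  also have "\<dots> = - (1 / (real n + 1))"
    by (simp add: field_simps)
  finally have "ln (real n) \<le> ln (real n + 1) - 1 / (real n + 1)"
    using that by (simp add: ln_div)
  also have "\<dots> \<le> harm (Suc n) - 2 / (real n + 1)"
    using ln_le_harm[of n] by (simp add: harm_Suc divide_inverse add_ac)
  finally have "ln (real n) / 2 \<le> harm (Suc n) / 2 - 1 / (real n + 1)" by simp
  also have "harm (Suc n) / 2 \<le> (\<Sum>m\<le>n. 1 / (2 * real m + 1))"
    unfolding harm_altdef sum_divide_distrib lessThan_Suc_atMost
    by (intro sum_mono) (simp add: field_simps)
  finally show ?thesis by simp
qed

text \<open>A sum of odd integers has the parity of its number of terms. That number is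
  \<open>k + 1\<close> for \<open>k \<le> n\<close> and \<open>2 * n - k + 1\<close> otherwise, so
  it is odd for even \<open>k\<close>.\<close>

lemma odd_autocorrelation_coeff:
  fixes P :: "'a :: {comm_ring_1,ring_char_0} poly" and a :: "nat \<Rightarrow> int"
  assumes deg: "degree P = n" and a: "\<And>i. i \<le> n \<Longrightarrow> coeff P i = of_int (a i) \<and> odd (a i)"
    and k: "even k" "k \<le> 2 * n"
  obtains c where "odd c" "coeff (P * reflect_poly P) k = of_int c"
proof
  define b where "b i = (if i \<le> n \<and> k - i \<le> n then a i * a (n - (k - i)) else 0)" for i
  have "coeff P i * coeff (reflect_poly P) (k - i) = of_int (b i)" for i
    unfolding coeff_reflect_poly b_def using a deg by (auto simp: coeff_eq_0)
  then show "coeff (P * reflect_poly P) k = of_int (\<Sum>i\<le>k. b i)"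
    by (simp add: coeff_mult)
  \<comment> \<open>Truncated subtraction makes the lower end 0 when
    \<open>k \<le> n\<close>.\<close>
  have "{i\<in>{..k}. odd (b i)} = {k - n..min k n}"
    unfolding b_def using a by auto
  then show "odd (\<Sum>i\<le>k. b i)"
    using k by (cases "k \<le> n") (simp_all add: even_sum_iff min_def)
qed

text \<open>The sign \<open>\<sigma>\<close> handles both extrema at once: \<open>1\<close> bounds
  the maximum from below, \<open>-1\<close> the minimum from above.\<close>

lemma littlewood_abs_deviation:
  assumes "n \<ge> 1" and P: "P \<in> littlewood_polys n" and \<sigma>: "\<sigma> = 1 \<or> \<sigma> = (-1::real)"
    and le: "\<And>t. \<sigma> * ((cmod (poly P (cis t)))\<^sup>2 - (real n + 1)) \<le> M"
  shows "ln (real n) / (4 * pi) \<le> M"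
proof -
  from P have deg: "degree P = n" and pm: "\<And>i. i \<le> n \<Longrightarrow> coeff P i = -1 \<or> coeff P i = 1"
    by (auto simp: littlewood_polys_def)
  define f where "f t = \<sigma> * ((cmod (poly P (cis t)))\<^sup>2 - (real n + 1))" for t
  define F where "F = P * reflect_poly P - monom (of_nat (n + 1)) n"

  have real: "coeff P i \<in> \<real>" for i
    using pm[of i] deg by (cases "i \<le> n") (auto simp: coeff_eq_0)
  have "poly F (cis t) = cis t ^ n * of_real ((cmod (poly P (cis t)))\<^sup>2 - (real n + 1))" for t
  proof -
    \<comment> \<open>The coefficients are real and \<open>1 / cis t\<close> is the conjugate of
      \<open>cis t\<close>, so reflection is conjugation up to the factor
      \<open>cis t ^ n\<close>.\<close>
    have "poly (reflect_poly P) (cis t) = cis t ^ n * cnj (poly P (cis t))"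
      using poly_reflect_poly_nz[of "cis t" P] poly_cnj_real[OF real, of "cis t"] deg
      by (simp add: cis_cnj)
    then show ?thesis
      unfolding F_def by (simp add: poly_monom complex_norm_square algebra_simps del: of_real_power)
  qed
  then have abs_f: "\<bar>f t\<bar> = cmod (poly F (cis t))" for t
    unfolding f_def using \<sigma> by (auto simp: norm_mult norm_power simp del: of_real_diff)

  \<comment> \<open>By Parseval the mean of \<open>|P|^2\<close> is \<open>n + 1\<close>, so
    \<open>f\<close> has mean zero.\<close>
  have "((\<lambda>t. (cmod (poly P (cis t)))\<^sup>2) has_integral 2 * pi * (\<Sum>k\<le>n. (cmod (coeff P k))\<^sup>2)) {0..2 * pi}"
    using parseval_finite[of "coeff P" "{..n}"] by (simp add: poly_altdef deg Complex.DeMoivre)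
  also have "(\<Sum>k\<le>n. (cmod (coeff P k))\<^sup>2) = (\<Sum>k\<le>n. 1)"
    by (intro sum.cong refl) (use pm in fastforce)
  finally have "(f has_integral \<sigma> * (2 * pi * (\<Sum>k\<le>n. 1) - (2 * pi - 0) *\<^sub>R (real n + 1))) {0..2 * pi}"
    unfolding f_def
    using has_integral_const_real[of "real n + 1" 0 "2 * pi"]
    by (intro has_integral_mult_right has_integral_diff) auto
  then have int_f: "(f has_integral 0) {0..2 * pi}" by (simp add: algebra_simps)

  have "\<exists>a::int. coeff P i = of_int a \<and> odd a" if "i \<le> n" for i
    using pm[OF that] by (metis odd_one of_int_1 of_int_minus even_minus)
  then obtain a :: "nat \<Rightarrow> int" where a: "\<And>i. i \<le> n \<Longrightarrow> coeff P i = of_int (a i) \<and> odd (a i)"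
    by metis
  have coeff: "1 \<le> cmod (coeff F (2 * m))" if m: "m \<le> n" "2 * m \<noteq> n" for m
  proof -
    obtain c where "odd c" "coeff (P * reflect_poly P) (2 * m) = of_int c"
      by (rule odd_autocorrelation_coeff[OF deg a, of "2 * m"]) (use m in auto)
    moreover from \<open>odd c\<close> have "\<bar>c\<bar> \<ge> 1" by (cases "c = 0") auto
    ultimately show ?thesis
      using m unfolding F_def by simp
  qed

  \<comment> \<open>The extra summand at \<open>m = n div 2\<close> pays for the missing middle
    coefficient when \<open>n\<close> is even; for odd \<open>n\<close> it is only slack.\<close>
  have "(\<Sum>m\<le>n. 1 / (2 * real m + 1))
      \<le> (\<Sum>m\<le>n. cmod (coeff F (2 * m)) / (2 * real m + 1) + (if m = n div 2 then 1 / (real n + 1) else 0))"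
  proof (intro sum_mono)
    fix m assume "m \<in> {..n}"
    show "1 / (2 * real m + 1)
        \<le> cmod (coeff F (2 * m)) / (2 * real m + 1) + (if m = n div 2 then 1 / (real n + 1) else 0)"
    proof (cases "2 * m = n")
      case False
      with coeff[of m] \<open>m \<in> {..n}\<close> show ?thesis
        by (intro add_increasing2 divide_right_mono) auto
    qed auto
  qed
  also have "\<dots> = (\<Sum>m\<le>n. cmod (coeff F (2 * m)) / (2 * real m + 1)) + 1 / (real n + 1)"
    by (simp add: sum.distrib)
  finally have "ln (real n) / 2 \<le> (\<Sum>m\<le>n. cmod (coeff F (2 * m)) / (2 * real m + 1))"
    using sum_inverse_odd_ge[OF \<open>n \<ge> 1\<close>] by simp
  also have "\<dots> = (\<Sum>k\<in>(\<lambda>m. 2 * m) ` {..n}. cmod (coeff F k) / (real k + 1))"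
    by (subst sum.reindex) (auto simp: inj_on_def)
  \<comment> \<open>The odd indices are added back at no cost, their terms being
    nonnegative.\<close>
  also have "\<dots> \<le> (\<Sum>k<2 * n + 1. cmod (coeff F k) / (real k + 1))"
    by (intro sum_mono2) auto
  also have "\<dots> \<le> 2 * pi * M"
    by (rule hardy_one_sided[OF int_f abs_f]) (use le in \<open>simp add: f_def\<close>)
  finally show ?thesis by (simp add: field_simps)
qed

section \<open>Attained extrema and the final bounds\<close>

text \<open>Replaces the noncompact parameter line by the compact circle, so that the extrema are
  attained and \<open>LEAST\<close> and \<open>GREATEST\<close> denote them.\<close>

lemma sq_mod_circle_range:
  "range (\<lambda>t::real. (cmod (poly P (exp (\<i> * of_real t))))\<^sup>2) = (\<lambda>z. (cmod (poly P z))\<^sup>2) ` sphere 0 1"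
proof -
  have "range (\<lambda>t::real. exp (\<i> * of_real t)) = sphere 0 1"
  proof (intro equalityI subsetI)
    fix z :: complex assume "z \<in> sphere 0 1"
    then have "z = exp (\<i> * of_real (Arg z))"
      using complex_norm_eq_1_exp_eq[of z] by simp
    then show "z \<in> range (\<lambda>t::real. exp (\<i> * of_real t))" by (rule range_eqI)
  qed auto
  then show ?thesis
    by (simp add: image_image flip: \<open>range _ = _\<close>)
qed

lemma min_sq_mod_circle_le: "min_sq_mod_circle P \<le> (cmod (poly P (cis t)))\<^sup>2"
proof -
  define R where "R = (\<lambda>z. (cmod (poly P z))\<^sup>2) ` sphere 0 1"
  have "compact R"
    unfolding R_def by (intro compact_continuous_image continuous_intros compact_sphere)
  moreover have "R \<noteq> {}"
    unfolding R_def by simp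
  ultimately have "\<exists>y\<in>R. \<forall>x\<in>R. y \<le> x"
    by (rule compact_attains_inf)
  then obtain y where y: "y \<in> R" "\<And>x. x \<in> R \<Longrightarrow> y \<le> x"
    by blast
  have "min_sq_mod_circle P = y"
    unfolding min_sq_mod_circle_def sq_mod_circle_range R_def[symmetric]
    by (rule Least_equality) (fact y)+
  moreover have "(cmod (poly P (cis t)))\<^sup>2 \<in> R"
    unfolding R_def by simp
  ultimately show ?thesis
    using y(2) by simp
qed

lemma max_sq_mod_circle_ge: "(cmod (poly P (cis t)))\<^sup>2 \<le> max_sq_mod_circle P"
proof -
  define R where "R = (\<lambda>z. (cmod (poly P z))\<^sup>2) ` sphere 0 1"
  have "compact R"
    unfolding R_def by (intro compact_continuous_image continuous_intros compact_sphere)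
  moreover have "R \<noteq> {}"
    unfolding R_def by simp
  ultimately have "\<exists>y\<in>R. \<forall>x\<in>R. x \<le> y"
    by (rule compact_attains_sup)
  then obtain y where y: "y \<in> R" "\<And>x. x \<in> R \<Longrightarrow> x \<le> y"
    by blast
  have "max_sq_mod_circle P = y"
    unfolding max_sq_mod_circle_def sq_mod_circle_range R_def[symmetric]
    by (rule Greatest_equality) (fact y)+
  moreover have "(cmod (poly P (cis t)))\<^sup>2 \<in> R"
    unfolding R_def by simp
  ultimately show ?thesis
    using y(2) by simp
qed

theorem theorem2p3:
  fixes n :: nat and P :: "complex poly"
  assumes "n \<ge> 1" and "P \<in> littlewood_polys n"
  shows "min_sq_mod_circle P \<le> (real n + 1) - ln (real n) / (4 * pi)
       \<and> (n \<ge> 2 \<longrightarrow> (real n + 1) - ln (real n) / (4 * pi) < (real n + 1) + ln (real n) / (4 * pi))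
       \<and> (real n + 1) + ln (real n) / (4 * pi) \<le> max_sq_mod_circle P"
proof (intro conjI impI)
  have "ln (real n) / (4 * pi) \<le> real n + 1 - min_sq_mod_circle P"
    by (rule littlewood_abs_deviation[OF assms, of "-1"]) (simp_all add: min_sq_mod_circle_le)
  then show "min_sq_mod_circle P \<le> (real n + 1) - ln (real n) / (4 * pi)" by simp
  have "ln (real n) / (4 * pi) \<le> max_sq_mod_circle P - (real n + 1)"
    by (rule littlewood_abs_deviation[OF assms, of 1]) (simp_all add: max_sq_mod_circle_ge)
  then show "(real n + 1) + ln (real n) / (4 * pi) \<le> max_sq_mod_circle P" by simp
  \<comment> \<open>At \<open>n = 1\<close> the logarithm vanishes and the two middle terms
    coincide.\<close>
  assume "n \<ge> 2"
  then have "0 < ln (real n) / (4 * pi)" by simp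
  then show "(real n + 1) - ln (real n) / (4 * pi) < (real n + 1) + ln (real n) / (4 * pi)" by simp
qed

end
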